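(* Let $m,n\ge 1$ and $1\le k\le m$ be integers, let $\alpha\in\mathbb{R}$ and $B\in M_{m,n}$. The map $\Phi^{-}_{\alpha,B}:M_n\to M_m$, $\Phi^{-}_{\alpha,B}(X)=\alpha\,\mathrm{tr}(X)I_m-BXB^*$, is $k$-copositive if and only if $\alpha\ge\sigma_1(B)^2$.
   Context: $M_{m,n}$ is the set of $m\times n$ complex matrices, $M_n=M_{n,n}$, and $\sigma_1(B)$ is the largest singular value of $B$. A linear map $\Phi:M_n\to M_m$ is $k$-positive if for every positive semidefinite block matrix $[A_{ij}]_{i,j=1}^k$ with $A_{ij}\in M_n$, the block matrix $[\Phi(A_{ij})]_{i,j=1}^k$ is positive semidefinite. $\Phi$ is $k$-copositive if $\Phi\circ\mathbf{T}$ is $k$-positive, where $\mathbf{T}(A)=A^\top$ is the transpose map on $M_n$. *)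

theory Defs
  imports "Jordan_Normal_Form.Char_Poly" "Jordan_Normal_Form.Schur_Decomposition"
begin

definition mat_trace :: "complex mat \<Rightarrow> complex" where
  "mat_trace A = (\<Sum>i<dim_row A. A $$ (i, i))"

text \<open>The order on \<^typ>\<open>complex\<close> is the one of \<^theory>\<open>HOL-Library.Complex_Order\<close>: \<open>0 \<le> z\<close> says that \<open>z\<close> is
  real and nonnegative. Since \<open>v\<close> ranges over all complex vectors, the condition
  \<open>v\<^sup>* M v \<ge> 0\<close> therefore forces \<open>M\<close> to be Hermitian.\<close>

definition psd_mat :: "nat \<Rightarrow> complex mat \<Rightarrow> bool" where
  "psd_mat n M \<longleftrightarrow> M \<in> carrier_mat n n \<and> (\<forall>v \<in> carrier_vec n. 0 \<le> (M *\<^sub>v v) \<bullet>c v)"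

text \<open>The \<open>kn \<times> kn\<close> matrix with \<open>n \<times> n\<close> blocks \<open>A i j\<close>, where \<open>i, j < k\<close>.\<close>

definition block_mat :: "nat \<Rightarrow> nat \<Rightarrow> (nat \<Rightarrow> nat \<Rightarrow> complex mat) \<Rightarrow> complex mat" where
  "block_mat k n A =
     mat (k * n) (k * n) (\<lambda>(p, q). A (p div n) (q div n) $$ (p mod n, q mod n))"

definition linear_mat_map :: "nat \<Rightarrow> nat \<Rightarrow> (complex mat \<Rightarrow> complex mat) \<Rightarrow> bool" where
  "linear_mat_map n m \<Phi> \<longleftrightarrow>
     (\<forall>X \<in> carrier_mat n n. \<Phi> X \<in> carrier_mat m m) \<and>
     (\<forall>X \<in> carrier_mat n n. \<forall>Y \<in> carrier_mat n n. \<Phi> (X + Y) = \<Phi> X + \<Phi> Y) \<and>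
     (\<forall>c. \<forall>X \<in> carrier_mat n n. \<Phi> (c \<cdot>\<^sub>m X) = c \<cdot>\<^sub>m \<Phi> X)"

definition k_positive :: "nat \<Rightarrow> nat \<Rightarrow> nat \<Rightarrow> (complex mat \<Rightarrow> complex mat) \<Rightarrow> bool" where
  "k_positive n m k \<Phi> \<longleftrightarrow>
     linear_mat_map n m \<Phi> \<and>
     (\<forall>A. (\<forall>i<k. \<forall>j<k. A i j \<in> carrier_mat n n) \<longrightarrow>
          psd_mat (k * n) (block_mat k n A) \<longrightarrow>
          psd_mat (k * m) (block_mat k m (\<lambda>i j. \<Phi> (A i j))))"

definition k_copositive :: "nat \<Rightarrow> nat \<Rightarrow> nat \<Rightarrow> (complex mat \<Rightarrow> complex mat) \<Rightarrow> bool" where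
  "k_copositive n m k \<Phi> \<longleftrightarrow> k_positive n m k (\<Phi> \<circ> transpose_mat)"

text \<open>For an \<open>m \<times> n\<close> matrix with \<open>m < n\<close> this set also contains \<open>0\<close> from the kernel of
  \<open>B\<close>, which does not affect the largest element. It is nonempty as soon as \<open>n \<ge> 1\<close>.\<close>

definition singular_values :: "complex mat \<Rightarrow> real set" where
  "singular_values B =
     {s. 0 \<le> s \<and> eigenvalue (mat_adjoint B * B) (complex_of_real (s\<^sup>2))}"

definition largest_singular_value :: "complex mat \<Rightarrow> real" where
  "largest_singular_value B = Max (singular_values B)"

definition Phi_minus :: "real \<Rightarrow> complex mat \<Rightarrow> complex mat \<Rightarrow> complex mat" where
  "Phi_minus \<alpha> B X =
     (complex_of_real \<alpha> * mat_trace X) \<cdot>\<^sub>m 1\<^sub>m (dim_row B) - B * X * mat_adjoint B"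

end

theory Submission
  imports Defs "Jordan_Normal_Form.Spectral_Radius"
begin

text \<open>Write a positive semidefinite block matrix as a sum of rank one matrices \<open>x x\<^sup>*\<close>. Testing the image
  of \<open>x x\<^sup>*\<close> under the map composed with transposition on a vector \<open>w\<close> gives
  \<open>\<alpha> \<Sum>\<bar>Y\<^sub>a\<^sub>c\<bar>\<^sup>2 - \<Sum> Z\<^sub>e\<^sub>a cnj Z\<^sub>a\<^sub>e\<close>, where \<open>Y\<close> is the \<open>n \<times> m\<close> matrix \<open>X\<^sup>T cnj W\<close> made from the blocks
  of \<open>x\<close> and \<open>w\<close>, and \<open>Z = Y B\<close>. The second sum is at most the squared Frobenius norm of \<open>Y B\<close>, hence
  at most \<open>\<sigma>\<^sub>1(B)\<^sup>2\<close> times that of \<open>Y\<close>. Conversely, if \<open>x\<close> and \<open>w\<close> live in a single block, the form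
  is \<open>\<alpha> \<bar>v\<bar>\<^sup>2 \<bar>w\<bar>\<^sup>2 - \<bar>w\<^sup>* B v\<bar>\<^sup>2\<close>, and a top right singular vector \<open>v\<close> with \<open>w = B v\<close> forces
  \<open>\<alpha> \<ge> \<sigma>\<^sub>1(B)\<^sup>2\<close>.\<close>

subsection \<open>Positive semidefinite kernels\<close>

text \<open>Evaluation at \<open>s\<close> = 0, 1, -1 and \<open>\<i>\<close> fixes all imaginary
  parts, and a suitable real multiple of \<open>cnj b\<close> gives the discriminant inequality.
  Symmetry, Cauchy-Schwarz and the Schur complement below are all read off from coefficients in this
  way.\<close>

lemma nonneg_quadratic_coeffs:
  fixes a b c d :: complex
  assumes *: "\<And>s. 0 \<le> a + s * b + cnj s * c + s * cnj s * d"
  shows "c = cnj b" and "0 \<le> a" and "0 \<le> d" and "(cmod b)\<^sup>2 \<le> Re a * Re d"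
proof -
  have a: "0 \<le> Re a" "Im a = 0" using *[of 0] by (auto simp: less_eq_complex_def)
  have i: "Im (b + c + d) = 0" "Im (d - b - c) = 0" "Im (\<i> * b - \<i> * c + d) = 0"
    using *[of 1] *[of "-1"] *[of \<i>] a by (auto simp: less_eq_complex_def)
  then have d: "Im d = 0" by simp
  show c: "c = cnj b" using i by (simp add: complex_eq_iff)
  have r: "0 \<le> Re a + 2 * Re (s * b) + (cmod s)\<^sup>2 * Re d" for s
  proof -
    have "Re (s * cnj s * d) = (cmod s)\<^sup>2 * Re d"
      by (simp add: cmod_power2 d) (simp add: power2_eq_square algebra_simps)
    moreover have "Re (s * b) = Re (cnj s * c)" unfolding c by simp
    moreover have "0 \<le> Re (a + s * b + cnj s * c + s * cnj s * d)"
      using *[of s] unfolding less_eq_complex_def by simp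
    ultimately show ?thesis unfolding plus_complex.sel by linarith
  qed
  have d0: "0 \<le> Re d"
  proof (rule ccontr)
    assume "\<not> 0 \<le> Re d"
    then have neg: "Re d < 0" by simp
    \<comment> \<open>Chosen so that \<open>s\<^sup>2 * Re d\<close> is \<open>- (Re a + 1)\<close>.
      Adding the inequalities for \<open>s\<close> and \<open>- s\<close> cancels the linear term
      and leaves -1.\<close>
    define s where "s = sqrt ((Re a + 1) / - Re d)"
    have "(Re a + 1) / - Re d \<ge> 0" using a neg by (intro divide_nonneg_nonneg) auto
    then have "s\<^sup>2 = (Re a + 1) / - Re d" unfolding s_def by simp
    then have "s\<^sup>2 * Re d = - (Re a + 1)" using neg by (simp add: field_simps)
    moreover have "0 \<le> Re a + s\<^sup>2 * Re d"
      using r[of "of_real s"] r[of "- of_real s"] by simp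
    ultimately show False by simp
  qed
  show "0 \<le> a" "0 \<le> d" using a d d0 by (auto simp: less_eq_complex_def)
  \<comment> \<open>The phase of \<open>s = - t * cnj b\<close> turns the linear term into a real
    one of known sign, leaving a real quadratic in \<open>t\<close>.\<close>
  have t: "0 \<le> Re a - 2 * t * (cmod b)\<^sup>2 + t\<^sup>2 * (cmod b)\<^sup>2 * Re d" for t :: real
  proof -
    have "Re (- of_real t * cnj b * b) = - t * (cmod b)\<^sup>2"
      by (simp add: cmod_power2) (simp add: power2_eq_square algebra_simps)
    moreover have "(cmod (- of_real t * cnj b))\<^sup>2 = t\<^sup>2 * (cmod b)\<^sup>2"
      by (simp add: norm_mult power_mult_distrib)
    ultimately show ?thesis using r[of "- of_real t * cnj b"] by simp
  qed
  show "(cmod b)\<^sup>2 \<le> Re a * Re d"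
  proof (cases "Re d = 0")
    case True
    have "cmod b = 0"
    proof (rule ccontr)
      assume "cmod b \<noteq> 0"
      \<comment> \<open>With \<open>Re d = 0\<close> the inequality is affine in \<open>t\<close>,
        and this \<open>t\<close> gives it the value -1.\<close>
      then show False using t[of "(Re a + 1) / (2 * (cmod b)\<^sup>2)"] a True by (simp add: field_simps)
    qed
    then show ?thesis using True by simp
  next
    case False
    then have "0 < Re d" using d0 by simp
    \<comment> \<open>The minimum of the quadratic in \<open>t\<close>.\<close>
    then show ?thesis using t[of "1 / Re d"] by (simp add: field_simps power2_eq_square)
  qed
qed

text \<open>The form u^* p v for a kernel on an index set rather than a matrix, so that an induction
  can enlarge the set by \<open>insert\<close>.\<close>

definition sesq :: "'a set \<Rightarrow> ('a \<Rightarrow> 'a \<Rightarrow> complex) \<Rightarrow> ('a \<Rightarrow> complex) \<Rightarrow> ('a \<Rightarrow> complex) \<Rightarrow> complex" where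
  "sesq I p u v = (\<Sum>i\<in>I. \<Sum>j\<in>I. cnj (u i) * p i j * v j)"

definition psd_on :: "'a set \<Rightarrow> ('a \<Rightarrow> 'a \<Rightarrow> complex) \<Rightarrow> bool" where
  "psd_on I p \<longleftrightarrow> (\<forall>v. 0 \<le> sesq I p v v)"

lemma sesq_expand:
  "sesq I p (\<lambda>i. u i + s * v i) (\<lambda>i. u i + s * v i) =
     sesq I p u u + s * sesq I p u v + cnj s * sesq I p v u + s * cnj s * sesq I p v v"
  by (simp add: sesq_def algebra_simps sum.distrib sum_distrib_left)

text \<open>Positivity at \<open>u + s v\<close> for all complex \<open>s\<close> is a nonnegative
  quadratic polynomial whose coefficients are the four values of the form.\<close>

lemma
  assumes "psd_on I p"
  shows psd_on_hermitian_form: "sesq I p v u = cnj (sesq I p u v)"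
    and psd_on_Cauchy_Schwarz:
      "(cmod (sesq I p u v))\<^sup>2 \<le> Re (sesq I p u u) * Re (sesq I p v v)"
proof -
  have "0 \<le> sesq I p u u + s * sesq I p u v + cnj s * sesq I p v u + s * cnj s * sesq I p v v" for s
    using assms unfolding sesq_expand[symmetric] psd_on_def by blast
  from nonneg_quadratic_coeffs[OF this]
  show "sesq I p v u = cnj (sesq I p u v)"
    and "(cmod (sesq I p u v))\<^sup>2 \<le> Re (sesq I p u u) * Re (sesq I p v v)" by auto
qed

lemma sesq_indicator_left:
  assumes "finite I" "x \<in> I"
  shows "sesq I p (\<lambda>i. if i = x then 1 else 0) v = (\<Sum>j\<in>I. p x j * v j)"
proof -
  have "sesq I p (\<lambda>i. if i = x then 1 else 0) v = (\<Sum>i\<in>I. if i = x then \<Sum>j\<in>I. p x j * v j else 0)"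
    unfolding sesq_def by (rule sum.cong) auto
  then show ?thesis using assms by simp
qed

lemma psd_on_hermitian:
  assumes "psd_on I p" "finite I" "x \<in> I" "y \<in> I"
  shows "p y x = cnj (p x y)"
proof -
  define e :: "'a \<Rightarrow> 'a \<Rightarrow> complex" where "e z = (\<lambda>i. if i = z then 1 else 0)" for z
  have "sesq I p (e z) (e z') = p z z'" if "z \<in> I" "z' \<in> I" for z z'
    using that assms(2) unfolding e_def by (simp add: sesq_indicator_left if_distrib cong: if_cong)
  then show ?thesis using psd_on_hermitian_form[OF assms(1), of "e y" "e x"] assms(3,4) by simp
qed

section \<open>Schur complements and Gram decompositions\<close>

text \<open>Isolates the coordinate at \<open>x\<close>: for fixed \<open>v\<close> the form becomes
  a polynomial in \<open>s\<close> of the shape treated by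
  \<open>nonneg_quadratic_coeffs\<close>.\<close>

lemma sesq_insert_fun_upd:
  assumes "finite I" "x \<notin> I"
  shows "sesq (insert x I) p (v(x := s)) (v(x := s)) =
    sesq I p v v + s * (\<Sum>i\<in>I. cnj (v i) * p i x) + cnj s * (\<Sum>j\<in>I. p x j * v j) + s * cnj s * p x x"
proof -
  have I: "i \<noteq> x" if "i \<in> I" for i using that assms by auto
  have "sesq (insert x I) p (v(x := s)) (v(x := s)) =
    cnj s * p x x * s + (\<Sum>j\<in>I. cnj s * p x j * v j)
      + (\<Sum>i\<in>I. cnj (v i) * p i x * s + (\<Sum>j\<in>I. cnj (v i) * p i j * v j))"
    using assms by (simp add: sesq_def I cong: sum.cong)
  also have "\<dots> = sesq I p v v + s * (\<Sum>i\<in>I. cnj (v i) * p i x) + cnj s * (\<Sum>j\<in>I. p x j * v j) + s * cnj s * p x x"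
    by (simp add: sesq_def sum.distrib sum_distrib_left algebra_simps)
  finally show ?thesis .
qed

text \<open>No case distinction on \<open>p x x = 0\<close> is needed: then \<open>p i x = 0\<close>, and the quotient is \<open>0\<close>.\<close>

lemma
  assumes psd: "psd_on (insert x I) p" and I: "finite I" "x \<notin> I"
  shows psd_on_Schur_complement: "psd_on I (\<lambda>i j. p i j - p i x * p x j / p x x)"
    and psd_on_diag_nonneg: "0 \<le> p x x"
    and psd_on_zero_diag: "\<And>i. p x x = 0 \<Longrightarrow> i \<in> I \<Longrightarrow> p i x = 0"
proof -
  define b c where "b v = (\<Sum>i\<in>I. cnj (v i) * p i x)" and "c v = (\<Sum>j\<in>I. p x j * v j)" for v
  have q: "0 \<le> sesq I p v v + s * b v + cnj s * c v + s * cnj s * p x x" for s v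
    using psd sesq_insert_fun_upd[OF I, of p v s] unfolding psd_on_def b_def c_def by metis
  note r = nonneg_quadratic_coeffs[OF q]
  show d: "0 \<le> p x x" by (rule r(3))
  show "p i x = 0" if "p x x = 0" "i \<in> I" for i
  proof -
    have "b (\<lambda>j. if j = i then 1 else 0) = (\<Sum>j\<in>I. if j = i then p i x else 0)"
      unfolding b_def by (rule sum.cong) auto
    then have "b (\<lambda>j. if j = i then 1 else 0) = p i x" using that I by simp
    then show ?thesis using r(4)[of "\<lambda>j. if j = i then 1 else 0"] that by simp
  qed
  show "psd_on I (\<lambda>i j. p i j - p i x * p x j / p x x)"
    unfolding psd_on_def
  proof
    fix v
    \<comment> \<open>The rank one correction lowers the form by |b v|^2 / p x x, since
      \<open>c v\<close> is the conjugate of \<open>b v\<close>. The discriminant inequality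
      \<open>r(4)\<close> says that the form is at least this large.\<close>
    have "sesq I (\<lambda>i j. p i j - p i x * p x j / p x x) v v = sesq I p v v - b v * c v / p x x"
      unfolding sesq_def b_def c_def sum_product sum_divide_distrib
      by (simp add: algebra_simps sum_subtractf)
    also have "\<dots> = of_real (Re (sesq I p v v)) - of_real ((cmod (b v))\<^sup>2) / of_real (Re (p x x))"
    proof -
      have "b v * c v = of_real ((cmod (b v))\<^sup>2)"
        using r(1)[of v] by (simp only: complex_norm_square)
      moreover have "of_real (Re (p x x)) = p x x"
        using d by (simp add: less_eq_complex_def complex_eq_iff)
      moreover have "of_real (Re (sesq I p v v)) = sesq I p v v"
        using r(2)[of v] by (simp add: less_eq_complex_def complex_eq_iff)
      ultimately show ?thesis by (simp only:)
    qed
    finally have e: "sesq I (\<lambda>i j. p i j - p i x * p x j / p x x) v v =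
      of_real (Re (sesq I p v v) - (cmod (b v))\<^sup>2 / Re (p x x))" by simp
    have "(cmod (b v))\<^sup>2 / Re (p x x) \<le> Re (sesq I p v v)"
    proof (cases "Re (p x x) = 0")
      case True then show ?thesis using r(2)[of v] by (simp add: less_eq_complex_def)
    next
      case False
      then have "0 < Re (p x x)" using d by (simp add: less_eq_complex_def)
      then show ?thesis using r(4)[of v] by (simp add: field_simps)
    qed
    then show "0 \<le> sesq I (\<lambda>i j. p i j - p i x * p x j / p x x) v v"
      unfolding e by (simp add: less_eq_complex_def)
  qed
qed

text \<open>Cholesky factorisation by induction on the index set: the Schur complement at
  \<open>x\<close> is factored on \<open>I\<close>, and the scaled column of \<open>x\<close>
  supplies one more rank one term.\<close>

lemma psd_on_Gram:
  assumes "finite I" "psd_on I p"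
  shows "\<exists>N r. \<forall>i\<in>I. \<forall>j\<in>I. p i j = (\<Sum>l<(N::nat). r l i * cnj (r l j))"
  using assms
proof (induction I arbitrary: p rule: finite_induct)
  case empty
  then show ?case by simp
next
  case (insert x I)
  note psd = insert.prems and I = insert.hyps
  from insert.IH[OF psd_on_Schur_complement[OF psd I]] obtain N r where
    r: "\<And>i j. i \<in> I \<Longrightarrow> j \<in> I \<Longrightarrow> p i j - p i x * p x j / p x x = (\<Sum>l<(N::nat). r l i * cnj (r l j))"
    by blast
  define d where "d = Re (p x x)"
  have d: "p x x = of_real d" "0 \<le> d"
    using psd_on_diag_nonneg[OF psd I] unfolding d_def by (auto simp: less_eq_complex_def complex_eq_iff)
  have sq: "p i x / of_real (sqrt d) * cnj (p j x / of_real (sqrt d)) = p i x * p x j / p x x"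
    if "j \<in> insert x I" for i j
  proof -
    have "p x j = cnj (p j x)" using psd_on_hermitian[OF psd, of j x] that I by auto
    moreover have "complex_of_real (sqrt d) * complex_of_real (sqrt d) = of_real d"
      using d(2) by (simp flip: of_real_mult)
    ultimately show ?thesis unfolding d(1) by simp
  qed
  \<comment> \<open>The old vectors are extended by 0 at \<open>x\<close>; the new one, with index
    \<open>N\<close>, is the column of \<open>x\<close> divided by the root of the diagonal entry.
    For \<open>d = 0\<close> division by zero makes it the zero vector.\<close>
  define r' where "r' l i = (if l = N then p i x / of_real (sqrt d) else if i = x then 0 else r l i)" for l i
  have "p i j = (\<Sum>l<Suc N. r' l i * cnj (r' l j))" if ij: "i \<in> insert x I" "j \<in> insert x I" for i j
  proof -
    have last: "r' N i * cnj (r' N j) = p i x * p x j / p x x"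
      using sq[OF ij(2), of i] by (simp add: r'_def)
    show ?thesis
    proof (cases "i = x \<or> j = x")
      case True
      then have "(\<Sum>l<N. r' l i * cnj (r' l j)) = 0" by (auto simp: r'_def intro!: sum.neutral)
      moreover have "p i j = p i x * p x j / p x x"
      proof (cases "p x x = 0")
        case z: True
        \<comment> \<open>A vanishing diagonal entry of a positive semidefinite kernel forces its
          whole column, and by symmetry its row, to vanish.\<close>
        have "p i x = 0" "p j x = 0" using psd_on_zero_diag[OF psd I z] z ij by auto
        then have "p i j = 0" using True psd_on_hermitian[OF psd, of j i] ij I by auto
        then show ?thesis using z by simp
      next
        case False
        then show ?thesis using True by auto
      qed
      ultimately show ?thesis using last by simp
    next
      case False
      then have "i \<in> I" "j \<in> I" using ij by auto
      have "(\<Sum>l<N. r' l i * cnj (r' l j)) = (\<Sum>l<N. r l i * cnj (r l j))"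
        using False by (intro sum.cong) (auto simp: r'_def)
      then show ?thesis using last r[OF \<open>i \<in> I\<close> \<open>j \<in> I\<close>] by (simp add: algebra_simps)
    qed
  qed
  then show ?case by blast
qed

subsection \<open>Hermitian matrices with nonnegative eigenvalues\<close>

text \<open>Each product |v i| |v j| is at most |v|^2, so the sum of all |p i j| is a bound; adding
  1 makes it strictly positive.\<close>

lemma sesq_bounded:
  assumes "finite I"
  shows "\<exists>K>0. \<forall>v. \<bar>Re (sesq I p v v)\<bar> \<le> K * (\<Sum>i\<in>I. (cmod (v i))\<^sup>2)"
proof -
  define S where "S v = (\<Sum>i\<in>I. (cmod (v i))\<^sup>2)" for v :: "'a \<Rightarrow> complex"
  define K where "K = (\<Sum>i\<in>I. \<Sum>j\<in>I. cmod (p i j))"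
  have "\<bar>Re (sesq I p v v)\<bar> \<le> (K + 1) * S v" for v
  proof -
    have S: "(cmod (v i))\<^sup>2 \<le> S v" if "i \<in> I" for i
      unfolding S_def using assms that by (intro member_le_sum) auto
    have "S v \<ge> 0" unfolding S_def by (intro sum_nonneg) auto
    have "\<bar>Re (sesq I p v v)\<bar> \<le> cmod (sesq I p v v)" by (rule abs_Re_le_cmod)
    also have "\<dots> \<le> (\<Sum>i\<in>I. \<Sum>j\<in>I. cmod (cnj (v i) * p i j * v j))"
      unfolding sesq_def by (intro order_trans[OF norm_sum] sum_mono norm_sum)
    also have "\<dots> \<le> (\<Sum>i\<in>I. \<Sum>j\<in>I. cmod (p i j) * S v)"
    proof (intro sum_mono)
      fix i j assume "i \<in> I" "j \<in> I"
      have "2 * (cmod (v i) * cmod (v j)) \<le> (cmod (v i))\<^sup>2 + (cmod (v j))\<^sup>2"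
        using sum_squares_bound[of "cmod (v i)" "cmod (v j)"] by (simp add: mult.assoc)
      then have "cmod (v i) * cmod (v j) \<le> S v" using S[OF \<open>i \<in> I\<close>] S[OF \<open>j \<in> I\<close>] by simp
      then have "cmod (p i j) * (cmod (v i) * cmod (v j)) \<le> cmod (p i j) * S v"
        by (rule mult_left_mono) simp
      then show "cmod (cnj (v i) * p i j * v j) \<le> cmod (p i j) * S v"
        by (simp add: norm_mult mult_ac)
    qed
    also have "\<dots> = K * S v" unfolding K_def by (simp add: sum_distrib_right)
    also have "\<dots> \<le> (K + 1) * S v" using \<open>S v \<ge> 0\<close> by (simp add: algebra_simps)
    finally show ?thesis .
  qed
  moreover have "K + 1 > 0" unfolding K_def by (simp add: add_nonneg_pos sum_nonneg)
  ultimately show ?thesis unfolding S_def by blast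
qed

lemma sesq_eq_adjoint_sum:
  "sesq I p u v = (\<Sum>i\<in>I. cnj (u i) * (\<Sum>j\<in>I. p i j * v j))"
  by (simp add: sesq_def sum_distrib_left mult.assoc)

text \<open>Put w = s v, so that q w = v. Cauchy-Schwarz for \<open>q\<close> gives |v|^4 \<le> (v^*
  q v) (w^* q w), and w^* q w is the conjugate of v^* s v, hence at most a constant times |v|^2.
  This gives a positive lower bound for the form on unit vectors without diagonalising
  \<open>q\<close>.\<close>

lemma psd_on_invertible_coercive:
  assumes psd: "psd_on I q" and fin: "finite I"
    and inv: "\<And>i j. i \<in> I \<Longrightarrow> j \<in> I \<Longrightarrow> (\<Sum>l\<in>I. q i l * s l j) = (if i = j then 1 else 0)"
  shows "\<exists>K>0. \<forall>v. (\<Sum>i\<in>I. (cmod (v i))\<^sup>2) \<le> K * Re (sesq I q v v)"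
proof -
  define S where "S v = (\<Sum>i\<in>I. (cmod (v i))\<^sup>2)" for v :: "'a \<Rightarrow> complex"
  obtain K where K: "K > 0" "\<And>v. \<bar>Re (sesq I s v v)\<bar> \<le> K * S v"
    using sesq_bounded[OF fin, of s] unfolding S_def by blast
  have "S v \<le> K * Re (sesq I q v v)" for v
  proof (cases "S v = 0")
    case True
    have "0 \<le> Re (sesq I q v v)" using psd unfolding psd_on_def by (simp add: less_eq_complex_def)
    then show ?thesis using True K(1) by simp
  next
    case False
    then have "S v > 0" unfolding S_def by (simp add: order_less_le sum_nonneg)
    define w where "w l = (\<Sum>j\<in>I. s l j * v j)" for l
    have qw: "(\<Sum>l\<in>I. q i l * w l) = v i" if "i \<in> I" for i
    proof -
      have "(\<Sum>l\<in>I. q i l * w l) = (\<Sum>l\<in>I. \<Sum>j\<in>I. q i l * s l j * v j)"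
        unfolding w_def by (simp add: sum_distrib_left mult.assoc)
      also have "\<dots> = (\<Sum>j\<in>I. \<Sum>l\<in>I. q i l * s l j * v j)" by (rule sum.swap)
      also have "\<dots> = (\<Sum>j\<in>I. if i = j then v j else 0)"
        using that by (intro sum.cong refl) (simp add: inv sum_distrib_right[symmetric])
      finally show ?thesis using fin that by simp
    qed
    have vw: "sesq I q v w = of_real (S v)"
      unfolding sesq_eq_adjoint_sum S_def of_real_sum
      by (intro sum.cong refl) (simp only: qw complex_norm_square mult.commute[of "cnj _"])
    have "sesq I q w w = (\<Sum>i\<in>I. cnj (w i) * v i)"
      unfolding sesq_eq_adjoint_sum by (intro sum.cong refl) (simp only: qw)
    also have "\<dots> = cnj (sesq I s v v)"
      unfolding sesq_eq_adjoint_sum w_def[symmetric] by (simp add: mult.commute)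
    finally have ww: "Re (sesq I q w w) \<le> K * S v" using K(2)[of v] by simp
    have "S v * S v \<le> Re (sesq I q v v) * Re (sesq I q w w)"
      using psd_on_Cauchy_Schwarz[OF psd, of v w] unfolding vw by (simp add: power2_eq_square)
    also have "\<dots> \<le> Re (sesq I q v v) * (K * S v)"
      using ww psd unfolding psd_on_def by (intro mult_left_mono) (auto simp: less_eq_complex_def)
    finally show ?thesis using \<open>S v > 0\<close> by (simp add: mult_ac)
  qed
  then show ?thesis using K(1) unfolding S_def by blast
qed

text \<open>The matrix \<open>A - e I\<close> has nonzero determinant, hence an inverse. The
  entrywise form matches the hypothesis \<open>inv\<close> of
  \<open>psd_on_invertible_coercive\<close>.\<close>

lemma right_inverse_if_not_eigenvalue:
  fixes A :: "complex mat"
  assumes A: "A \<in> carrier_mat n n" and "\<not> eigenvalue A e"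
  shows "\<exists>s. \<forall>i<n. \<forall>j<n.
    (\<Sum>l<n. (A $$ (i, l) + (if i = l then - e else 0)) * s l j) = (if i = j then 1 else 0)"
proof -
  define C where "C = char_matrix A e"
  have C: "C \<in> carrier_mat n n" using A unfolding C_def char_matrix_def by auto
  have "det C \<noteq> 0" using assms eigenvalue_det[OF A] unfolding C_def by simp
  from det_non_zero_imp_unit[OF C this, of "()"] obtain D where
    D: "D \<in> carrier_mat n n" "C * D = 1\<^sub>m n"
    unfolding Units_def ring_mat_def by auto
  have "(\<Sum>l<n. (A $$ (i, l) + (if i = l then - e else 0)) * D $$ (l, j)) = (if i = j then 1 else 0)"
    if "i < n" "j < n" for i j
  proof -
    have "(\<Sum>l<n. (A $$ (i, l) + (if i = l then - e else 0)) * D $$ (l, j)) = (C * D) $$ (i, j)"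
      using that A C D(1) by (auto simp: scalar_prod_def lessThan_atLeast0 C_def char_matrix_def intro!: sum.cong)
    then show ?thesis using that unfolding D(2) by simp
  qed
  then show ?thesis by (intro exI[of _ "\<lambda>i j. D $$ (i, j)"]) blast
qed

lemma sesq_add_diag:
  assumes "finite I"
  shows "sesq I (\<lambda>i j. p i j + (if i = j then of_real t else 0)) v v =
    sesq I p v v + of_real (t * (\<Sum>i\<in>I. (cmod (v i))\<^sup>2))"
proof -
  have "sesq I (\<lambda>i j. p i j + (if i = j then of_real t else 0)) v v =
    (\<Sum>i\<in>I. \<Sum>j\<in>I. cnj (v i) * p i j * v j + (if i = j then of_real t * (v i * cnj (v i)) else 0))"
    unfolding sesq_def by (intro sum.cong refl) (auto simp: algebra_simps)
  also have "\<dots> = sesq I p v v + (\<Sum>i\<in>I. of_real t * (v i * cnj (v i)))"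
    using assms by (simp add: sum.distrib sesq_def)
  finally show ?thesis
    by (simp only: of_real_mult of_real_sum complex_norm_square sum_distrib_left)
qed

text \<open>The least \<open>t \<ge> 0\<close> making \<open>A + t I\<close> positive semidefinite must be \<open>0\<close>: if \<open>t > 0\<close>, then \<open>- t\<close> is
  not an eigenvalue, so \<open>A + t I\<close> is coercive and \<open>t\<close> can be decreased.\<close>

lemma hermitian_nonneg_eigenvalues_psd:
  fixes A :: "complex mat"
  assumes A: "A \<in> carrier_mat n n"
    and herm: "\<And>i j. i < n \<Longrightarrow> j < n \<Longrightarrow> A $$ (j, i) = cnj (A $$ (i, j))"
    and ev: "\<And>\<mu> :: real. eigenvalue A (of_real \<mu>) \<Longrightarrow> 0 \<le> \<mu>"
  shows "psd_on {..<n} (\<lambda>i j. A $$ (i, j))"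
proof -
  define p where "p i j = A $$ (i, j)" for i j
  define S where "S v = (\<Sum>i<n. (cmod (v i))\<^sup>2)" for v :: "nat \<Rightarrow> complex"
  define f where "f v = sesq {..<n} p v v" for v
  define q where "q t i j = p i j + (if i = j then complex_of_real t else 0)" for t i j
  have S0: "S v \<ge> 0" for v unfolding S_def by (intro sum_nonneg) auto
  have q: "sesq {..<n} (q t) v v = f v + of_real (t * S v)" for t v
    unfolding q_def f_def S_def by (rule sesq_add_diag) simp
  have cnj_f: "cnj (f v) = f v" for v
  proof -
    have "cnj (f v) = (\<Sum>i<n. \<Sum>j<n. cnj (v j) * p j i * v i)"
      unfolding f_def sesq_def cnj_sum
    proof (intro sum.cong refl)
      fix i j assume "i \<in> {..<n}" "j \<in> {..<n}"
      then have "p j i = cnj (p i j)" unfolding p_def by (intro herm) auto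
      then show "cnj (cnj (v i) * p i j * v j) = cnj (v j) * p j i * v i"
        by (simp only: complex_cnj_mult complex_cnj_cnj mult_ac)
    qed
    also have "\<dots> = f v" unfolding f_def sesq_def by (rule sum.swap)
    finally show ?thesis .
  qed
  have Im_f: "Im (f v) = 0" for v using arg_cong[OF cnj_f[of v], of Im] by simp
  define T where "T = {t. 0 \<le> t \<and> (\<forall>v. 0 \<le> Re (f v) + t * S v)}"
  have psd_T: "psd_on {..<n} (q t)" if "t \<in> T" for t
    using that unfolding psd_on_def q T_def by (simp add: less_eq_complex_def Im_f)
  obtain K where K: "K > 0" "\<And>v. \<bar>Re (f v)\<bar> \<le> K * S v"
    using sesq_bounded[of "{..<n}" p] unfolding f_def S_def by auto
  have Kf: "0 \<le> Re (f v) + K * S v" for v using K(2)[of v] by linarith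
  have "K \<in> T" using K(1) Kf unfolding T_def by simp
  define t0 where "t0 = Inf T"
  have bdd: "bdd_below T" unfolding T_def by (rule bdd_belowI[of _ 0]) simp
  have "t0 \<ge> 0" unfolding t0_def using \<open>K \<in> T\<close> by (intro cInf_greatest) (auto simp: T_def)
  \<comment> \<open>The infimum is attained: for \<open>S v > 0\<close> the condition on
    \<open>t\<close> is the closed one t \<ge> - Re (f v) / S v, and for \<open>S v = 0\<close> it
    does not depend on \<open>t\<close> and holds at \<open>K\<close>.\<close>
  have "0 \<le> Re (f v) + t0 * S v" for v
  proof (cases "S v = 0")
    case True
    then show ?thesis using Kf[of v] by simp
  next
    case False
    then have pos: "S v > 0" using S0[of v] by simp
    have "- Re (f v) / S v \<le> t0" unfolding t0_def
    proof (rule cInf_greatest)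
      show "T \<noteq> {}" using \<open>K \<in> T\<close> by blast
      fix t assume "t \<in> T"
      then have "0 \<le> Re (f v) + t * S v" unfolding T_def by blast
      then show "- Re (f v) / S v \<le> t" using pos by (simp add: field_simps)
    qed
    then show ?thesis using pos by (simp add: field_simps)
  qed
  then have t0T: "t0 \<in> T" using \<open>t0 \<ge> 0\<close> unfolding T_def by blast
  have "t0 = 0"
  proof (rule ccontr)
    assume "t0 \<noteq> 0"
    then have "t0 > 0" using \<open>t0 \<ge> 0\<close> by simp
    then have "\<not> eigenvalue A (of_real (- t0))" using ev[of "- t0"] by linarith
    from right_inverse_if_not_eigenvalue[OF A this] obtain s where
      s: "\<And>i j. i < n \<Longrightarrow> j < n \<Longrightarrow> (\<Sum>l<n. q t0 i l * s l j) = (if i = j then 1 else 0)"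
      unfolding q_def p_def of_real_minus minus_minus by blast
    obtain C where C: "C > 0" "\<And>v. S v \<le> C * Re (sesq {..<n} (q t0) v v)"
      using psd_on_invertible_coercive[OF psd_T[OF t0T], of s] s unfolding S_def by auto
    \<comment> \<open>Coercivity with constant \<open>C\<close> leaves room to lower the shift by
      \<open>1 / C\<close>; the maximum with 0 keeps \<open>t\<close> in the range allowed by
      \<open>T\<close>.\<close>
    define t where "t = max 0 (t0 - 1 / C)"
    have "0 \<le> Re (f v) + t * S v" for v
    proof -
      have "S v / C \<le> Re (f v) + t0 * S v"
        using C(2)[of v] C(1) unfolding q by (simp add: field_simps)
      then have "0 \<le> Re (f v) + (t0 - 1 / C) * S v" by (simp add: algebra_simps)
      also have "\<dots> \<le> Re (f v) + t * S v"
        unfolding t_def by (intro add_left_mono mult_right_mono S0) simp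
      finally show ?thesis .
    qed
    then have "t \<in> T" unfolding T_def t_def by simp
    then have "t0 \<le> t" unfolding t0_def using bdd by (rule cInf_lower)
    moreover have "t < t0" unfolding t_def using \<open>t0 > 0\<close> C(1) by simp
    ultimately show False by simp
  qed
  then have "psd_on {..<n} (q 0)" using psd_T t0T by simp
  moreover have "q 0 = (\<lambda>i j. A $$ (i, j))" unfolding q_def p_def by (auto simp: fun_eq_iff)
  ultimately show ?thesis by simp
qed

subsection \<open>The quadratic form of a block image\<close>

lemma index_mat_adjoint:
  fixes B :: "complex mat"
  assumes "i < dim_col B" "j < dim_row B"
  shows "mat_adjoint B $$ (i, j) = cnj (B $$ (j, i))"
  using assms by (simp add: mat_adjoint_def mat_of_rows_index conjugate_complex_def)

lemma carrier_mat_adjoint: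
  "B \<in> carrier_mat m n \<Longrightarrow> mat_adjoint B \<in> carrier_mat n m"
  by (auto simp: mat_adjoint_def)

text \<open>Passes from vectors of dimension \<open>n\<close> to functions on the naturals: the form
  sees only the values below \<open>n\<close>, so \<open>v\<close> may be replaced by
  \<open>vec n v\<close>.\<close>

lemma psd_mat_iff_psd_on:
  "psd_mat n M \<longleftrightarrow> M \<in> carrier_mat n n \<and> psd_on {..<n} (\<lambda>i j. M $$ (i, j))"
proof (cases "M \<in> carrier_mat n n")
  case True
  have form: "(M *\<^sub>v v) \<bullet>c v = sesq {..<n} (\<lambda>i j. M $$ (i, j)) (($) v) (($) v)" if "v \<in> carrier_vec n" for v
    using True that
    by (auto simp: sesq_def scalar_prod_def lessThan_atLeast0 sum_distrib_right sum_distrib_left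
        conjugate_complex_def mult_ac intro!: sum.cong)
  have "psd_on {..<n} (\<lambda>i j. M $$ (i, j))" if "psd_mat n M"
    unfolding psd_on_def
  proof
    fix v :: "nat \<Rightarrow> complex"
    have "0 \<le> (M *\<^sub>v vec n v) \<bullet>c vec n v"
      using that vec_carrier[of n v] unfolding psd_mat_def by blast
    also have "\<dots> = sesq {..<n} (\<lambda>i j. M $$ (i, j)) (($) (vec n v)) (($) (vec n v))"
      by (rule form) simp
    also have "\<dots> = sesq {..<n} (\<lambda>i j. M $$ (i, j)) v v"
      unfolding sesq_def by (intro sum.cong refl) auto
    finally show "0 \<le> sesq {..<n} (\<lambda>i j. M $$ (i, j)) v v" .
  qed
  moreover have "psd_mat n M" if "psd_on {..<n} (\<lambda>i j. M $$ (i, j))"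
    using that True form unfolding psd_mat_def psd_on_def by simp
  ultimately show ?thesis using True by blast
qed (simp add: psd_mat_def)

lemma sesq_cong:
  assumes "\<And>i j. i \<in> I \<Longrightarrow> j \<in> I \<Longrightarrow> p i j = q i j"
  shows "sesq I p u v = sesq I q u v"
  unfolding sesq_def using assms by (intro sum.cong refl) simp

lemma index_block_mat:
  assumes "p < k * n" "q < k * n"
  shows "block_mat k n A $$ (p, q) = A (p div n) (q div n) $$ (p mod n, q mod n)"
  using assms by (simp add: block_mat_def)

lemma carrier_block_mat: "block_mat k n A \<in> carrier_mat (k * n) (k * n)"
  by (simp add: block_mat_def)

text \<open>Transposition leaves the trace alone but puts \<open>X $$ (b, a)\<close> in place of
  \<open>X $$ (a, b)\<close> in the second term. This swap is the origin of the crossed indices in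
  the sums \<open>Z e a * cnj (Z a e)\<close> below.\<close>

lemma index_Phi_minus_transpose:
  assumes B: "B \<in> carrier_mat m n" and X: "X \<in> carrier_mat n n" and "c < m" "d < m"
  shows "Phi_minus \<alpha> B (transpose_mat X) $$ (c, d) =
    of_real \<alpha> * (\<Sum>a<n. X $$ (a, a)) * (if c = d then 1 else 0)
      - (\<Sum>a<n. \<Sum>b<n. B $$ (c, a) * X $$ (b, a) * cnj (B $$ (d, b)))"
proof -
  define P where "P = B * transpose_mat X"
  have P: "P \<in> carrier_mat m n" using B X unfolding P_def by auto
  have "P $$ (c, b) = (\<Sum>a<n. B $$ (c, a) * X $$ (b, a))" if "b < n" for b
    using assms that unfolding P_def by (auto simp: scalar_prod_def lessThan_atLeast0 intro!: sum.cong)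
  moreover have "(P * mat_adjoint B) $$ (c, d) = (\<Sum>b<n. P $$ (c, b) * cnj (B $$ (d, b)))"
    using P assms carrier_mat_adjoint[OF B]
    by (auto simp: scalar_prod_def lessThan_atLeast0 index_mat_adjoint intro!: sum.cong)
  ultimately have "(B * transpose_mat X * mat_adjoint B) $$ (c, d) =
    (\<Sum>b<n. (\<Sum>a<n. B $$ (c, a) * X $$ (b, a)) * cnj (B $$ (d, b)))"
    unfolding P_def by simp
  also have "\<dots> = (\<Sum>b<n. \<Sum>a<n. B $$ (c, a) * X $$ (b, a) * cnj (B $$ (d, b)))"
    by (simp add: sum_distrib_right)
  also have "\<dots> = (\<Sum>a<n. \<Sum>b<n. B $$ (c, a) * X $$ (b, a) * cnj (B $$ (d, b)))"
    by (rule sum.swap)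
  moreover have "mat_trace (transpose_mat X) = (\<Sum>a<n. X $$ (a, a))"
    using X unfolding mat_trace_def by (auto intro!: sum.cong)
  ultimately show ?thesis
    using assms carrier_mat_adjoint[OF B] unfolding Phi_minus_def by simp
qed

lemma dim_Phi_minus [simp]:
  "dim_row (Phi_minus \<alpha> B X) = dim_row B" "dim_col (Phi_minus \<alpha> B X) = dim_row B"
  unfolding Phi_minus_def by (simp_all add: mat_adjoint_def)

lemma linear_Phi_minus_transpose:
  assumes B: "B \<in> carrier_mat m n"
  shows "linear_mat_map n m (Phi_minus \<alpha> B \<circ> transpose_mat)"
  unfolding linear_mat_map_def comp_def
proof (intro conjI ballI allI)
  fix X Y :: "complex mat" and e :: complex
  assume X: "X \<in> carrier_mat n n"
  show "Phi_minus \<alpha> B (transpose_mat X) \<in> carrier_mat m m" using B by (intro carrier_matI) auto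
  show "Phi_minus \<alpha> B (transpose_mat (e \<cdot>\<^sub>m X)) = e \<cdot>\<^sub>m Phi_minus \<alpha> B (transpose_mat X)"
    using X B
    by (intro eq_matI) (auto simp: index_Phi_minus_transpose[OF B] right_diff_distrib sum_distrib_left mult_ac)
  assume Y: "Y \<in> carrier_mat n n"
  show "Phi_minus \<alpha> B (transpose_mat (X + Y)) =
      Phi_minus \<alpha> B (transpose_mat X) + Phi_minus \<alpha> B (transpose_mat Y)"
    using X Y B
    by (intro eq_matI) (auto simp: index_Phi_minus_transpose[OF B] sum.distrib algebra_simps)
qed

section \<open>Reduction to rank one block matrices\<close>

lemma sum_swap_pairs:
  "(\<Sum>a\<in>A. \<Sum>b\<in>B. \<Sum>p\<in>P. \<Sum>q\<in>Q. f a b p q) = (\<Sum>p\<in>P. \<Sum>q\<in>Q. \<Sum>a\<in>A. \<Sum>b\<in>B. f a b p q)"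
proof -
  have "(\<Sum>a\<in>A. \<Sum>b\<in>B. \<Sum>p\<in>P. \<Sum>q\<in>Q. f a b p q) = (\<Sum>a\<in>A. \<Sum>p\<in>P. \<Sum>q\<in>Q. \<Sum>b\<in>B. f a b p q)"
    by (simp only: sum.swap[where A = B])
  also have "\<dots> = (\<Sum>p\<in>P. \<Sum>q\<in>Q. \<Sum>a\<in>A. \<Sum>b\<in>B. f a b p q)"
    by (simp only: sum.swap[where A = A])
  finally show ?thesis .
qed

text \<open>The matrix \<open>Y\<close> of the overview. A flat index \<open>p\<close> stands for
  position \<open>p mod m\<close> in block \<open>p div m\<close>, so the entry at \<open>a\<close>,
  \<open>c\<close> is the sum over the blocks \<open>i\<close> of
  \<open>x i a * cnj (W (i * m + c))\<close>.\<close>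

definition block_pairing ::
  "nat \<Rightarrow> nat \<Rightarrow> (nat \<Rightarrow> nat \<Rightarrow> complex) \<Rightarrow> (nat \<Rightarrow> complex) \<Rightarrow> nat \<Rightarrow> nat \<Rightarrow> complex" where
  "block_pairing k m x W a c =
     (\<Sum>p<k * m. if p mod m = c then x (p div m) a * cnj (W p) else 0)"

text \<open>Every flat index \<open>p\<close> has exactly one residue \<open>c < m\<close>, so the
  sum over \<open>c\<close> collapses.\<close>

lemma block_pairing_mult_right:
  assumes "0 < m"
  shows "(\<Sum>c<m. block_pairing k m x W a c * g c) =
    (\<Sum>p<k * m. x (p div m) a * cnj (W p) * g (p mod m))"
proof -
  have "(\<Sum>c<m. block_pairing k m x W a c * g c) =
    (\<Sum>c<m. \<Sum>p<k * m. if p mod m = c then x (p div m) a * cnj (W p) * g c else 0)"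
    unfolding block_pairing_def sum_distrib_right by (intro sum.cong refl) auto
  also have "\<dots> = (\<Sum>p<k * m. \<Sum>c<m. if p mod m = c then x (p div m) a * cnj (W p) * g c else 0)"
    by (rule sum.swap)
  finally show ?thesis using assms by simp
qed

lemma sesq_diff: "sesq I (\<lambda>i j. p i j - q i j) u v = sesq I p u v - sesq I q u v"
  by (simp add: sesq_def algebra_simps sum_subtractf)

lemma sesq_scale: "sesq I (\<lambda>i j. t * p i j) u v = t * sesq I p u v"
  by (simp add: sesq_def sum_distrib_left mult_ac)

text \<open>Expanding over pairs of flat indices, the Kronecker delta of the trace term couples
  equal residues and yields the squared Frobenius norm of \<open>Y\<close>. The other term factors
  into entries of \<open>Z = Y B\<close> with crossed indices.\<close>

lemma sesq_rank_one_Phi_minus_transpose: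
  fixes x b :: "nat \<Rightarrow> nat \<Rightarrow> complex" and W :: "nat \<Rightarrow> complex" and k m n :: nat
  assumes m: "0 < m"
  defines "Z \<equiv> \<lambda>a e. \<Sum>c<m. block_pairing k m x W a c * b c e"
  shows "sesq {..<k * m} (\<lambda>p q.
      of_real \<alpha> * (\<Sum>a<n. x (p div m) a * cnj (x (q div m) a)) * (if p mod m = q mod m then 1 else 0)
      - (\<Sum>a<n. \<Sum>e<n. b (p mod m) a * (x (p div m) e * cnj (x (q div m) a)) * cnj (b (q mod m) e))) W W
    = of_real (\<alpha> * (\<Sum>a<n. \<Sum>c<m. (cmod (block_pairing k m x W a c))\<^sup>2)) - (\<Sum>a<n. \<Sum>e<n. Z e a * cnj (Z a e))"
proof -
  let ?Y = "block_pairing k m x W"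
  let ?I = "{..<k * m}"
  have "(\<Sum>a<n. \<Sum>c<m. ?Y a c * cnj (?Y a c)) =
    (\<Sum>a<n. \<Sum>p\<in>?I. x (p div m) a * cnj (W p) * cnj (?Y a (p mod m)))"
    by (simp only: block_pairing_mult_right[OF m])
  also have "\<dots> = (\<Sum>a<n. \<Sum>p\<in>?I. \<Sum>q\<in>?I. if p mod m = q mod m
      then cnj (W p) * (x (p div m) a * cnj (x (q div m) a)) * W q else 0)"
    unfolding block_pairing_def cnj_sum sum_distrib_left
    by (intro sum.cong refl) auto
  also have "\<dots> = (\<Sum>p\<in>?I. \<Sum>q\<in>?I. \<Sum>a<n. if p mod m = q mod m
      then cnj (W p) * (x (p div m) a * cnj (x (q div m) a)) * W q else 0)"
    by (simp only: sum.swap[where A = "{..<n}"])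
  also have "\<dots> = sesq ?I (\<lambda>p q. (\<Sum>a<n. x (p div m) a * cnj (x (q div m) a)) *
      (if p mod m = q mod m then 1 else 0)) W W"
    unfolding sesq_def by (intro sum.cong refl) (auto simp: sum_distrib_left sum_distrib_right)
  finally have 1: "sesq ?I (\<lambda>p q. (\<Sum>a<n. x (p div m) a * cnj (x (q div m) a)) *
      (if p mod m = q mod m then 1 else 0)) W W = of_real (\<Sum>a<n. \<Sum>c<m. (cmod (?Y a c))\<^sup>2)"
    by (simp only: of_real_sum complex_norm_square)
  have Z: "Z a e = (\<Sum>p\<in>?I. x (p div m) a * cnj (W p) * b (p mod m) e)" for a e
    unfolding Z_def by (rule block_pairing_mult_right[OF m])
  have "(\<Sum>a<n. \<Sum>e<n. Z e a * cnj (Z a e)) = (\<Sum>a<n. \<Sum>e<n. \<Sum>p\<in>?I. \<Sum>q\<in>?I.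
      x (p div m) e * cnj (W p) * b (p mod m) a * cnj (x (q div m) a * cnj (W q) * b (q mod m) e))"
    unfolding Z cnj_sum sum_product ..
  also have "\<dots> = (\<Sum>p\<in>?I. \<Sum>q\<in>?I. \<Sum>a<n. \<Sum>e<n.
      x (p div m) e * cnj (W p) * b (p mod m) a * cnj (x (q div m) a * cnj (W q) * b (q mod m) e))"
    by (rule sum_swap_pairs)
  also have "\<dots> = sesq ?I (\<lambda>p q. \<Sum>a<n. \<Sum>e<n.
      b (p mod m) a * (x (p div m) e * cnj (x (q div m) a)) * cnj (b (q mod m) e)) W W"
    unfolding sesq_def sum_distrib_left sum_distrib_right
    by (intro sum.cong refl) (simp add: mult_ac)
  finally show ?thesis
    unfolding sesq_diff mult.assoc[of "of_real \<alpha>"] sesq_scale 1 by simp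
qed

text \<open>The image depends linearly on the blocks, so a Gram decomposition of the block matrix
  splits the form into rank one contributions; \<open>x l i a\<close> is entry \<open>a\<close> in
  block \<open>i\<close> of the Gram vector with index \<open>l\<close>.\<close>

lemma Phi_minus_block_form:
  assumes B: "B \<in> carrier_mat m n" and m: "0 < m"
    and A: "\<And>i j. i < k \<Longrightarrow> j < k \<Longrightarrow> A i j \<in> carrier_mat n n"
    and x: "\<And>i j a b. i < k \<Longrightarrow> j < k \<Longrightarrow> a < n \<Longrightarrow> b < n \<Longrightarrow>
      A i j $$ (a, b) = (\<Sum>l<N. x l i a * cnj (x l j b))"
  defines "Z \<equiv> \<lambda>l W a e. \<Sum>c<m. block_pairing k m (x l) W a c * B $$ (c, e)"
  shows "sesq {..<k * m} (\<lambda>p q. block_mat k m (\<lambda>i j. (Phi_minus \<alpha> B \<circ> transpose_mat) (A i j)) $$ (p, q)) W W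
    = (\<Sum>l<(N::nat). of_real (\<alpha> * (\<Sum>a<n. \<Sum>c<m. (cmod (block_pairing k m (x l) W a c))\<^sup>2))
        - (\<Sum>a<n. \<Sum>e<n. Z l W e a * cnj (Z l W a e)))"
proof -
  define M where "M l p q = of_real \<alpha> * (\<Sum>a<n. x l (p div m) a * cnj (x l (q div m) a)) * (if p mod m = q mod m then 1 else 0)
      - (\<Sum>a<n. \<Sum>e<n. B $$ (p mod m, a) * (x l (p div m) e * cnj (x l (q div m) a)) * cnj (B $$ (q mod m, e)))"
    for l p q
  have "block_mat k m (\<lambda>i j. (Phi_minus \<alpha> B \<circ> transpose_mat) (A i j)) $$ (p, q) = (\<Sum>l<N. M l p q)"
    if "p < k * m" "q < k * m" for p q
  proof -
    have k: "p div m < k" "q div m < k" using that by (auto simp: less_mult_imp_div_less)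
    have "(\<Sum>l<N. M l p q) =
      of_real \<alpha> * (\<Sum>a<n. A (p div m) (q div m) $$ (a, a)) * (if p mod m = q mod m then 1 else 0)
      - (\<Sum>a<n. \<Sum>e<n. B $$ (p mod m, a) * A (p div m) (q div m) $$ (e, a) * cnj (B $$ (q mod m, e)))"
      unfolding M_def sum_subtractf
      by (simp add: x[OF k] sum.swap[where A = "{..<N}"] sum_distrib_left sum_distrib_right)
    then show ?thesis
      using that m by (simp add: index_block_mat index_Phi_minus_transpose[OF B A[OF k]])
  qed
  then have "sesq {..<k * m} (\<lambda>p q. block_mat k m (\<lambda>i j. (Phi_minus \<alpha> B \<circ> transpose_mat) (A i j)) $$ (p, q)) W W
    = sesq {..<k * m} (\<lambda>p q. \<Sum>l<N. M l p q) W W"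
    by (intro sesq_cong) simp
  also have "\<dots> = (\<Sum>l<N. sesq {..<k * m} (M l) W W)"
    unfolding sesq_def by (simp add: sum_distrib_left sum_distrib_right sum.swap[where B = "{..<N}"])
  also have "\<dots> = (\<Sum>l<N. of_real (\<alpha> * (\<Sum>a<n. \<Sum>c<m. (cmod (block_pairing k m (x l) W a c))\<^sup>2))
        - (\<Sum>a<n. \<Sum>e<n. Z l W e a * cnj (Z l W a e)))"
    unfolding M_def Z_def by (intro sum.cong refl sesq_rank_one_Phi_minus_transpose m)
  finally show ?thesis .
qed

text \<open>Conjugation exchanges \<open>a\<close> and \<open>e\<close>, so the sum is real. Each
  term is at most the mean of |z e a|^2 and |z a e|^2, and both of these add up to the squared
  Frobenius norm.\<close>

lemma sum_mult_cnj_swap_bound: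
  fixes z :: "nat \<Rightarrow> nat \<Rightarrow> complex"
  assumes "(\<Sum>a<n. \<Sum>e<n. (cmod (z a e))\<^sup>2) \<le> t"
  shows "0 \<le> of_real t - (\<Sum>a<n. \<Sum>e<n. z e a * cnj (z a e))"
proof -
  define s where "s = (\<Sum>a<n. \<Sum>e<n. z e a * cnj (z a e))"
  have "cnj s = (\<Sum>a<n. \<Sum>e<n. z a e * cnj (z e a))" unfolding s_def by (simp add: mult.commute)
  also have "\<dots> = s" unfolding s_def by (rule sum.swap)
  finally have im: "Im s = 0" by (simp add: complex_eq_iff)
  have "Re s \<le> (\<Sum>a<n. \<Sum>e<n. ((cmod (z e a))\<^sup>2 + (cmod (z a e))\<^sup>2) / 2)"
    unfolding s_def Re_sum
  proof (intro sum_mono)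
    fix a e
    have "Re (z e a * cnj (z a e)) \<le> cmod (z e a) * cmod (z a e)"
      using complex_Re_le_cmod[of "z e a * cnj (z a e)"] by (simp add: norm_mult)
    also have "\<dots> \<le> ((cmod (z e a))\<^sup>2 + (cmod (z a e))\<^sup>2) / 2"
      using sum_squares_bound[of "cmod (z e a)" "cmod (z a e)"] by simp
    finally show "Re (z e a * cnj (z a e)) \<le> ((cmod (z e a))\<^sup>2 + (cmod (z a e))\<^sup>2) / 2" .
  qed
  also have "\<dots> = (\<Sum>a<n. \<Sum>e<n. (cmod (z a e))\<^sup>2)"
    using sum.swap[of "\<lambda>a e. (cmod (z e a))\<^sup>2" "{..<n}" "{..<n}"]
    by (simp add: sum.distrib add_divide_distrib flip: sum_divide_distrib)
  finally have "Re s \<le> t" using assms by simp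
  then show ?thesis unfolding s_def[symmetric] by (simp add: less_eq_complex_def im)
qed

section \<open>Copositivity and bounds for the bilinear form of \<open>B\<close>\<close>

text \<open>For each Gram vector, \<open>bound\<close> applied to the rows of \<open>Y\<close>
  estimates the Frobenius norm of \<open>Y B\<close>, and \<open>sum_mult_cnj_swap_bound\<close>
  then absorbs the crossed sum.\<close>

lemma k_copositive_Phi_minus_if_bound:
  assumes B: "B \<in> carrier_mat m n" and m: "0 < m"
    and bound: "\<And>w :: nat \<Rightarrow> complex.
      (\<Sum>e<n. (cmod (\<Sum>c<m. w c * B $$ (c, e)))\<^sup>2) \<le> \<alpha> * (\<Sum>c<m. (cmod (w c))\<^sup>2)"
  shows "k_copositive n m k (Phi_minus \<alpha> B)"
  unfolding k_copositive_def k_positive_def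
proof (intro conjI allI impI linear_Phi_minus_transpose[OF B])
  fix A assume A: "\<forall>i<k. \<forall>j<k. A i j \<in> carrier_mat n n" and "psd_mat (k * n) (block_mat k n A)"
  then obtain N r where r: "\<And>p q. p < k * n \<Longrightarrow> q < k * n \<Longrightarrow>
      block_mat k n A $$ (p, q) = (\<Sum>l<(N::nat). r l p * cnj (r l q))"
    using psd_on_Gram[of "{..<k * n}" "\<lambda>p q. block_mat k n A $$ (p, q)"]
    unfolding psd_mat_iff_psd_on by auto
  \<comment> \<open>The Gram vectors are cut into blocks: \<open>i * n + a\<close> inverts the
    \<open>div\<close> and \<open>mod\<close> of \<open>block_mat\<close>.\<close>
  have x: "A i j $$ (a, b) = (\<Sum>l<N. r l (i * n + a) * cnj (r l (j * n + b)))"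
    if "i < k" "j < k" "a < n" "b < n" for i j a b
  proof -
    have "i * n + a < k * n" if "i < k" "a < n" for i a
    proof -
      have "i * n + a < Suc i * n" using that by simp
      also have "\<dots> \<le> k * n" using that by (intro mult_right_mono) auto
      finally show ?thesis .
    qed
    then have "i * n + a < k * n" "j * n + b < k * n" using that by auto
    from r[OF this] index_block_mat[OF this] show ?thesis using that by simp
  qed
  show "psd_mat (k * m) (block_mat k m (\<lambda>i j. (Phi_minus \<alpha> B \<circ> transpose_mat) (A i j)))"
    unfolding psd_mat_iff_psd_on psd_on_def
  proof (intro conjI carrier_block_mat allI)
    fix W
    note form = Phi_minus_block_form[OF B m, where A = A and x = "\<lambda>l i a. r l (i * n + a)" and W = W,
        OF A[rule_format] x]
    have "0 \<le> (\<Sum>l<N.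
      of_real (\<alpha> * (\<Sum>a<n. \<Sum>c<m. (cmod (block_pairing k m (\<lambda>i a. r l (i * n + a)) W a c))\<^sup>2))
      - (\<Sum>a<n. \<Sum>e<n. (\<Sum>c<m. block_pairing k m (\<lambda>i a. r l (i * n + a)) W e c * B $$ (c, a)) *
          cnj (\<Sum>c<m. block_pairing k m (\<lambda>i a. r l (i * n + a)) W a c * B $$ (c, e))))"
    proof (intro sum_nonneg sum_mult_cnj_swap_bound)
      fix l
      show "(\<Sum>a<n. \<Sum>e<n. (cmod (\<Sum>c<m. block_pairing k m (\<lambda>i a. r l (i * n + a)) W a c * B $$ (c, e)))\<^sup>2)
        \<le> \<alpha> * (\<Sum>a<n. \<Sum>c<m. (cmod (block_pairing k m (\<lambda>i a. r l (i * n + a)) W a c))\<^sup>2)"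
        unfolding sum_distrib_left[of \<alpha> _ "{..<n}"] by (intro sum_mono bound)
    qed
    then show "0 \<le> sesq {..<k * m} (\<lambda>p q. block_mat k m (\<lambda>i j. (Phi_minus \<alpha> B \<circ> transpose_mat) (A i j)) $$ (p, q)) W W"
      by (subst form) auto
  qed
qed

text \<open>With both vectors supported in block 0, \<open>Y\<close> is the rank one matrix with
  entries \<open>cnj (v a) * cnj (w c)\<close>. Then \<open>Y B\<close> has rank one too, and its
  crossed sum becomes |w^* B v|^2.\<close>

lemma k_copositive_Phi_minus_imp_bound:
  fixes v w :: "nat \<Rightarrow> complex"
  assumes B: "B \<in> carrier_mat m n" and m: "0 < m" and k: "0 < k"
    and pos: "k_copositive n m k (Phi_minus \<alpha> B)"
  shows "(cmod (\<Sum>a<n. (\<Sum>c<m. cnj (w c) * B $$ (c, a)) * v a))\<^sup>2 \<le>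
    \<alpha> * ((\<Sum>a<n. (cmod (v a))\<^sup>2) * (\<Sum>c<m. (cmod (w c))\<^sup>2))"
proof -
  \<comment> \<open>The conjugate compensates for the transposition, so that \<open>v\<close> itself
    appears in w^* B v.\<close>
  define x where "x i a = (if i = 0 then cnj (v a) else 0)" for i a :: nat
  define A where "A i j = mat n n (\<lambda>(a, b). x i a * cnj (x j b))" for i j
  define W where "W p = (if p < m then w p else 0)" for p
  have A: "A i j \<in> carrier_mat n n" for i j unfolding A_def by simp
  have xA: "A i j $$ (a, b) = (\<Sum>l<1::nat. x i a * cnj (x j b))" if "a < n" "b < n" for i j a b
    using that unfolding A_def by simp
  have "psd_mat (k * n) (block_mat k n A)"
    unfolding psd_mat_iff_psd_on psd_on_def
  proof (intro conjI carrier_block_mat allI)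
    fix z
    define s where "s = (\<Sum>p<k * n. cnj (z p) * x (p div n) (p mod n))"
    have "sesq {..<k * n} (\<lambda>p q. block_mat k n A $$ (p, q)) z z =
      sesq {..<k * n} (\<lambda>p q. x (p div n) (p mod n) * cnj (x (q div n) (q mod n))) z z"
    proof (rule sesq_cong)
      fix p q assume "p \<in> {..<k * n}" "q \<in> {..<k * n}"
      \<comment> \<open>An index below \<open>k * n\<close> exists only if \<open>n > 0\<close>,
        which puts the residues modulo \<open>n\<close> in range.\<close>
      moreover from this have "n > 0" by (cases n) auto
      ultimately show "block_mat k n A $$ (p, q) = x (p div n) (p mod n) * cnj (x (q div n) (q mod n))"
        by (simp add: index_block_mat A_def)
    qed
    also have "\<dots> = s * cnj s"
      unfolding s_def cnj_sum sum_product sesq_def by (simp add: mult_ac)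
    finally show "0 \<le> sesq {..<k * n} (\<lambda>p q. block_mat k n A $$ (p, q)) z z"
      by (simp add: less_eq_complex_def complex_mult_cnj)
  qed
  then have "0 \<le> sesq {..<k * m} (\<lambda>p q. block_mat k m (\<lambda>i j. (Phi_minus \<alpha> B \<circ> transpose_mat) (A i j)) $$ (p, q)) W W"
    using pos A unfolding k_copositive_def k_positive_def psd_mat_iff_psd_on psd_on_def by blast
  also have "\<dots> = (\<Sum>l<1::nat. of_real (\<alpha> * (\<Sum>a<n. \<Sum>c<m. (cmod (block_pairing k m x W a c))\<^sup>2))
        - (\<Sum>a<n. \<Sum>e<n. (\<Sum>c<m. block_pairing k m x W e c * B $$ (c, a)) *
            cnj (\<Sum>c<m. block_pairing k m x W a c * B $$ (c, e))))"
    by (rule Phi_minus_block_form[OF B m A xA])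
  finally have form: "0 \<le> of_real (\<alpha> * (\<Sum>a<n. \<Sum>c<m. (cmod (block_pairing k m x W a c))\<^sup>2))
        - (\<Sum>a<n. \<Sum>e<n. (\<Sum>c<m. block_pairing k m x W e c * B $$ (c, a)) *
            cnj (\<Sum>c<m. block_pairing k m x W a c * B $$ (c, e)))" by simp
  have Y: "block_pairing k m x W a c = cnj (v a) * cnj (w c)" if "c < m" for a c
  proof -
    have "1 * m \<le> k * m" using k by (intro mult_le_mono1) simp
    then have c: "c < k * m" using that by linarith
    \<comment> \<open>Since \<open>W\<close> vanishes from \<open>m\<close> on, only the index
      \<open>p = c\<close> in block 0 survives.\<close>
    have "block_pairing k m x W a c = (\<Sum>p<k * m. if p = c then cnj (v a) * cnj (w c) else 0)"
      unfolding block_pairing_def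
      by (intro sum.cong refl) (use that in \<open>auto simp: W_def x_def\<close>)
    then show ?thesis using c by simp
  qed
  define u where "u a = (\<Sum>c<m. cnj (w c) * B $$ (c, a))" for a
  have Z: "(\<Sum>c<m. block_pairing k m x W a c * B $$ (c, e)) = cnj (v a) * u e" for a e
    unfolding u_def sum_distrib_left by (intro sum.cong refl) (simp add: Y mult_ac)
  define s where "s = (\<Sum>a<n. u a * v a)"
  have "(\<Sum>a<n. \<Sum>e<n. (cnj (v e) * u a) * cnj (cnj (v a) * u e)) = s * cnj s"
    unfolding s_def cnj_sum sum_product by (simp add: mult_ac)
  then have s: "(\<Sum>a<n. \<Sum>e<n. (cnj (v e) * u a) * cnj (cnj (v a) * u e)) = of_real ((cmod s)\<^sup>2)"
    by (simp only: complex_norm_square)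
  have "(\<Sum>a<n. \<Sum>c<m. (cmod (block_pairing k m x W a c))\<^sup>2) =
    (\<Sum>a<n. \<Sum>c<m. (cmod (v a))\<^sup>2 * (cmod (w c))\<^sup>2)"
    by (intro sum.cong refl) (simp add: Y norm_mult power_mult_distrib)
  also have "\<dots> = (\<Sum>a<n. (cmod (v a))\<^sup>2) * (\<Sum>c<m. (cmod (w c))\<^sup>2)"
    by (simp add: sum_product)
  finally have "(cmod s)\<^sup>2 \<le> \<alpha> * ((\<Sum>a<n. (cmod (v a))\<^sup>2) * (\<Sum>c<m. (cmod (w c))\<^sup>2))"
    using form unfolding Z s by (simp flip: of_real_diff add: less_eq_complex_def)
  then show ?thesis unfolding s_def u_def .
qed

subsection \<open>Singular values\<close>

text \<open>The eigenvector equation in coordinates; the positive norm records that the eigenvector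
  is nonzero.\<close>

lemma eigenvalue_adjoint_mult:
  assumes B: "B \<in> carrier_mat m n" and "eigenvalue (mat_adjoint B * B) e"
  shows "\<exists>v. (\<Sum>a<n. (cmod (v a))\<^sup>2) > 0 \<and>
    (\<forall>a<n. (\<Sum>c<m. cnj (B $$ (c, a)) * (\<Sum>j<n. B $$ (c, j) * v j)) = e * v a)"
proof -
  note B' = carrier_mat_adjoint[OF B]
  obtain v where v: "v \<in> carrier_vec n" "v \<noteq> 0\<^sub>v n" "(mat_adjoint B * B) *\<^sub>v v = e \<cdot>\<^sub>v v"
    using assms(2) B B' unfolding eigenvalue_def eigenvector_def by auto
  have Bv: "(B *\<^sub>v v) $ c = (\<Sum>j<n. B $$ (c, j) * v $ j)" if "c < m" for c
    using that B v(1) by (auto simp: scalar_prod_def lessThan_atLeast0 intro!: sum.cong)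
  have "(\<Sum>c<m. cnj (B $$ (c, a)) * (\<Sum>j<n. B $$ (c, j) * v $ j)) = e * v $ a" if "a < n" for a
  proof -
    define w where "w = B *\<^sub>v v"
    have w: "w \<in> carrier_vec m" using B v(1) unfolding w_def by simp
    have "mat_adjoint B *\<^sub>v w = e \<cdot>\<^sub>v v"
      unfolding w_def using v B B' by (simp flip: assoc_mult_mat_vec)
    then have "(mat_adjoint B *\<^sub>v w) $ a = e * v $ a" using v(1) that by simp
    moreover have "(mat_adjoint B *\<^sub>v w) $ a = (\<Sum>c<m. cnj (B $$ (c, a)) * w $ c)"
      using that B B' w by (auto simp: scalar_prod_def lessThan_atLeast0 index_mat_adjoint intro!: sum.cong)
    ultimately show ?thesis unfolding w_def by (simp add: Bv)
  qed
  moreover have "(\<Sum>a<n. (cmod (v $ a))\<^sup>2) > 0"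
  proof -
    obtain a where "a < n" "v $ a \<noteq> 0"
      using v(1,2) by (metis carrier_vecD eq_vecI index_zero_vec)
    then show ?thesis by (intro sum_pos2[of _ a]) auto
  qed
  ultimately show ?thesis by blast
qed

text \<open>The identity |B v|^2 = v^* (B^* B v) = e |v|^2.\<close>

lemma adjoint_mult_eigenvector_norm:
  assumes "\<And>a. a < n \<Longrightarrow> (\<Sum>c<m. cnj (B $$ (c, a)) * (\<Sum>j<n. B $$ (c, j) * v j)) = e * v a"
  shows "of_real (\<Sum>c<m. (cmod (\<Sum>j<n. B $$ (c, j) * v j))\<^sup>2) = e * of_real (\<Sum>a<n. (cmod (v a))\<^sup>2)"
proof -
  define w where "w c = (\<Sum>j<n. B $$ (c, j) * v j)" for c
  have "of_real (\<Sum>c<m. (cmod (w c))\<^sup>2) = (\<Sum>c<m. w c * (\<Sum>a<n. cnj (B $$ (c, a)) * cnj (v a)))"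
    unfolding of_real_sum complex_norm_square by (simp add: w_def)
  also have "\<dots> = (\<Sum>a<n. (\<Sum>c<m. cnj (B $$ (c, a)) * w c) * cnj (v a))"
    by (simp add: sum_distrib_left sum_distrib_right sum.swap[where A = "{..<m}"] mult_ac)
  also have "\<dots> = (\<Sum>a<n. e * (v a * cnj (v a)))"
    using assms unfolding w_def by (intro sum.cong refl) simp
  also have "\<dots> = e * of_real (\<Sum>a<n. (cmod (v a))\<^sup>2)"
    unfolding of_real_sum complex_norm_square by (simp add: sum_distrib_left)
  finally show ?thesis unfolding w_def .
qed

text \<open>Squaring is injective on nonnegative reals and maps the singular values into a finite
  spectrum.\<close>

lemma finite_singular_values:
  assumes B: "B \<in> carrier_mat m n"
  shows "finite (singular_values B)"
proof -
  have "mat_adjoint B * B \<in> carrier_mat n n" using B carrier_mat_adjoint[OF B] by auto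
  then have "finite (spectrum (mat_adjoint B * B))" by (rule card_finite_spectrum)
  moreover have "inj_on (\<lambda>s. complex_of_real (s\<^sup>2)) (singular_values B)"
    by (rule inj_onI) (auto simp: singular_values_def power2_eq_iff simp flip: of_real_power)
  moreover have "(\<lambda>s. complex_of_real (s\<^sup>2)) ` singular_values B \<subseteq> spectrum (mat_adjoint B * B)"
    unfolding singular_values_def spectrum_def by auto
  ultimately show ?thesis by (metis finite_imageD finite_subset)
qed

text \<open>The spectrum of a complex matrix is nonempty, and the norm identity shows that an
  eigenvalue of B^* B is a quotient |B v|^2 / |v|^2, hence the square of a nonnegative real.\<close>

lemma singular_values_nonempty:
  assumes B: "B \<in> carrier_mat m n" and n: "0 < n"
  shows "singular_values B \<noteq> {}"
proof -
  have "mat_adjoint B * B \<in> carrier_mat n n" using B carrier_mat_adjoint[OF B] by auto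
  then obtain e where e: "eigenvalue (mat_adjoint B * B) e"
    using spectrum_non_empty[OF _ n] unfolding spectrum_def by blast
  obtain v where v: "(\<Sum>a<n. (cmod (v a))\<^sup>2) > 0"
      "\<And>a. a < n \<Longrightarrow> (\<Sum>c<m. cnj (B $$ (c, a)) * (\<Sum>j<n. B $$ (c, j) * v j)) = e * v a"
    using eigenvalue_adjoint_mult[OF B e] by blast
  define s t where "s = (\<Sum>c<m. (cmod (\<Sum>j<n. B $$ (c, j) * v j))\<^sup>2)" and "t = (\<Sum>a<n. (cmod (v a))\<^sup>2)"
  have "of_real s = e * of_real t"
    unfolding s_def t_def by (rule adjoint_mult_eigenvector_norm) (rule v(2))
  moreover have "s \<ge> 0" "t > 0" unfolding s_def t_def by (auto intro!: sum_nonneg v(1))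
  ultimately have "e = of_real (s / t)" "s / t \<ge> 0" by (auto simp: field_simps)
  then have "sqrt (s / t) \<in> singular_values B"
    using e unfolding singular_values_def by (simp del: of_real_power of_real_divide)
  then show ?thesis by blast
qed

section \<open>The largest singular value as an operator norm\<close>

text \<open>Singular values are defined through B^* B, while the bound needed concerns B B^*. The
  vector u = B^* v carries the eigenvalue over; it is nonzero because B u = l v is.\<close>

lemma eigenvalue_mult_adjoint_le:
  assumes B: "B \<in> carrier_mat m n" and l: "0 < l"
    and v: "v \<in> carrier_vec m" "v \<noteq> 0\<^sub>v m" "(B * mat_adjoint B) *\<^sub>v v = of_real l \<cdot>\<^sub>v v"
  shows "l \<le> (largest_singular_value B)\<^sup>2"
proof -
  note B' = carrier_mat_adjoint[OF B]
  define u where "u = mat_adjoint B *\<^sub>v v"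
  have u: "u \<in> carrier_vec n" unfolding u_def using B' v(1) by simp
  have Bu: "B *\<^sub>v u = of_real l \<cdot>\<^sub>v v"
    unfolding u_def using v B B' by (simp flip: assoc_mult_mat_vec)
  have "u \<noteq> 0\<^sub>v n"
  proof
    assume "u = 0\<^sub>v n"
    moreover have "B *\<^sub>v 0\<^sub>v n = 0\<^sub>v m" using B by (intro eq_vecI) auto
    ultimately have "of_real l \<cdot>\<^sub>v v = 0\<^sub>v m" using Bu by simp
    then have "(of_real l \<cdot>\<^sub>v v) $ i = 0" if "i < m" for i using that by simp
    then have "v $ i = 0" if "i < m" for i using that v(1) l by simp
    then have "v = 0\<^sub>v m" using v(1) by (intro eq_vecI) auto
    then show False using v(2) by simp
  qed
  moreover have "(mat_adjoint B * B) *\<^sub>v u = of_real l \<cdot>\<^sub>v u"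
  proof -
    have "(mat_adjoint B * B) *\<^sub>v u = mat_adjoint B *\<^sub>v (of_real l \<cdot>\<^sub>v v)"
      using u B B' by (simp add: Bu)
    then show ?thesis unfolding u_def using B' v(1) by (simp add: mult_mat_vec)
  qed
  ultimately have "eigenvalue (mat_adjoint B * B) (of_real l)"
    using u B B' unfolding eigenvalue_def eigenvector_def by auto
  then have "sqrt l \<in> singular_values B" using l unfolding singular_values_def by (simp del: of_real_power)
  then have "sqrt l \<le> largest_singular_value B"
    unfolding largest_singular_value_def using finite_singular_values[OF B] by simp
  then have "(sqrt l)\<^sup>2 \<le> (largest_singular_value B)\<^sup>2" using l by (intro power_mono) auto
  then show ?thesis using l by simp
qed

text \<open>The claim says that P = \<alpha> I - B B^* is positive semidefinite. A negative
  eigenvalue \<mu> of \<open>P\<close> would give B B^* the eigenvalue \<alpha> - \<mu>, which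
  exceeds the square of the largest singular value.\<close>

lemma norm_adjoint_mult_le_largest_singular_value:
  fixes w :: "nat \<Rightarrow> complex"
  assumes B: "B \<in> carrier_mat m n" and \<alpha>: "(largest_singular_value B)\<^sup>2 \<le> \<alpha>"
  shows "(\<Sum>e<n. (cmod (\<Sum>c<m. w c * B $$ (c, e)))\<^sup>2) \<le> \<alpha> * (\<Sum>c<m. (cmod (w c))\<^sup>2)"
proof -
  note B' = carrier_mat_adjoint[OF B]
  define P where "P = of_real \<alpha> \<cdot>\<^sub>m 1\<^sub>m m - B * mat_adjoint B"
  have BB: "B * mat_adjoint B \<in> carrier_mat m m" using B B' by auto
  have P: "P \<in> carrier_mat m m" unfolding P_def by (rule minus_carrier_mat[OF BB])
  have entry: "P $$ (c, d) = - (\<Sum>e<n. B $$ (c, e) * cnj (B $$ (d, e))) + (if c = d then of_real \<alpha> else 0)"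
    if "c < m" "d < m" for c d
  proof -
    have "(B * mat_adjoint B) $$ (c, d) = (\<Sum>e<n. B $$ (c, e) * cnj (B $$ (d, e)))"
      using that B B' by (auto simp: scalar_prod_def lessThan_atLeast0 index_mat_adjoint intro!: sum.cong)
    moreover have "P $$ (c, d) = (of_real \<alpha> \<cdot>\<^sub>m 1\<^sub>m m) $$ (c, d) - (B * mat_adjoint B) $$ (c, d)"
      unfolding P_def using that BB by (intro index_minus_mat) auto
    ultimately show ?thesis using that by simp
  qed
  have "psd_on {..<m} (\<lambda>i j. P $$ (i, j))"
  proof (rule hermitian_nonneg_eigenvalues_psd[OF P])
    show "P $$ (j, i) = cnj (P $$ (i, j))" if "i < m" "j < m" for i j
      using that by (simp add: entry mult.commute)
    fix \<mu> :: real
    assume "eigenvalue P (of_real \<mu>)"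
    then obtain v where v: "v \<in> carrier_vec m" "v \<noteq> 0\<^sub>v m" "P *\<^sub>v v = of_real \<mu> \<cdot>\<^sub>v v"
      using P unfolding eigenvalue_def eigenvector_def by auto
    show "0 \<le> \<mu>"
    proof (rule ccontr)
      assume neg: "\<not> 0 \<le> \<mu>"
      have "(of_real \<alpha> \<cdot>\<^sub>m 1\<^sub>m m) *\<^sub>v v = of_real \<alpha> \<cdot>\<^sub>v v"
        using v(1) by (intro eq_vecI) auto
      then have "P *\<^sub>v v = of_real \<alpha> \<cdot>\<^sub>v v - (B * mat_adjoint B) *\<^sub>v v"
        unfolding P_def using minus_mult_distrib_mat_vec[OF _ BB v(1), of "of_real \<alpha> \<cdot>\<^sub>m 1\<^sub>m m"] by simp
      moreover define u where "u = (B * mat_adjoint B) *\<^sub>v v"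
      ultimately have eq: "of_real \<mu> \<cdot>\<^sub>v v = of_real \<alpha> \<cdot>\<^sub>v v - u" using v(3) by simp
      have u: "u \<in> carrier_vec m" unfolding u_def using BB v(1) by (rule mult_mat_vec_carrier)
      have "u = of_real (\<alpha> - \<mu>) \<cdot>\<^sub>v v"
      proof (rule eq_vecI)
        fix i assume "i < dim_vec (of_real (\<alpha> - \<mu>) \<cdot>\<^sub>v v)"
        then have i: "i < m" using v(1) by simp
        have "of_real \<mu> * v $ i = of_real \<alpha> * v $ i - u $ i"
          using arg_cong[OF eq, of "\<lambda>u. u $ i"] i v(1) u by simp
        then show "u $ i = (of_real (\<alpha> - \<mu>) \<cdot>\<^sub>v v) $ i"
          using i v(1) by (simp add: algebra_simps)
      qed (use v(1) u in auto)
      then have "(B * mat_adjoint B) *\<^sub>v v = of_real (\<alpha> - \<mu>) \<cdot>\<^sub>v v" unfolding u_def .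
      moreover have "0 < \<alpha> - \<mu>" using neg \<alpha> zero_le_power2[of "largest_singular_value B"] by linarith
      ultimately have "\<alpha> - \<mu> \<le> (largest_singular_value B)\<^sup>2"
        using eigenvalue_mult_adjoint_le[OF B] v(1,2) by blast
      then show False using \<alpha> neg by simp
    qed
  qed
  \<comment> \<open>The form is evaluated at the conjugate of \<open>w\<close> because the bound
    pairs \<open>w\<close> with the columns of \<open>B\<close> without conjugation.\<close>
  then have "0 \<le> sesq {..<m} (\<lambda>i j. P $$ (i, j)) (\<lambda>c. cnj (w c)) (\<lambda>c. cnj (w c))"
    unfolding psd_on_def by blast
  also have "\<dots> = sesq {..<m} (\<lambda>c d. - (\<Sum>e<n. B $$ (c, e) * cnj (B $$ (d, e))) +
      (if c = d then of_real \<alpha> else 0)) (\<lambda>c. cnj (w c)) (\<lambda>c. cnj (w c))"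
    by (rule sesq_cong) (simp add: entry)
  also have "\<dots> = of_real (\<alpha> * (\<Sum>c<m. (cmod (w c))\<^sup>2)) -
      sesq {..<m} (\<lambda>c d. \<Sum>e<n. B $$ (c, e) * cnj (B $$ (d, e))) (\<lambda>c. cnj (w c)) (\<lambda>c. cnj (w c))"
    by (subst sesq_add_diag) (simp_all add: sesq_def sum_negf)
  also have "sesq {..<m} (\<lambda>c d. \<Sum>e<n. B $$ (c, e) * cnj (B $$ (d, e))) (\<lambda>c. cnj (w c)) (\<lambda>c. cnj (w c))
      = (\<Sum>e<n. (\<Sum>c<m. w c * B $$ (c, e)) * cnj (\<Sum>d<m. w d * B $$ (d, e)))"
    unfolding sesq_def cnj_sum sum_product
    by (simp add: sum_distrib_left sum_distrib_right sum.swap[where B = "{..<n}"] mult_ac)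
  also have "\<dots> = of_real (\<Sum>e<n. (cmod (\<Sum>c<m. w c * B $$ (c, e)))\<^sup>2)"
    by (simp only: of_real_sum complex_norm_square)
  finally show ?thesis by (simp flip: of_real_diff add: less_eq_complex_def)
qed

text \<open>For a top right singular vector \<open>v\<close> and w = B v, the pairing w^* B v equals
  |w|^2 = \<sigma>^2 |v|^2, so \<open>bound\<close> reads \<sigma>^4 |v|^4 \<le> \<alpha> \<sigma>^2
  |v|^4.\<close>

lemma largest_singular_value_le_if_bound:
  assumes B: "B \<in> carrier_mat m n" and m: "0 < m" and n: "0 < n"
    and bound: "\<And>v w. (cmod (\<Sum>a<n. (\<Sum>c<m. cnj (w c) * B $$ (c, a)) * v a))\<^sup>2 \<le>
      \<alpha> * ((\<Sum>a<n. (cmod (v a))\<^sup>2) * (\<Sum>c<m. (cmod (w c))\<^sup>2))"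
  shows "(largest_singular_value B)\<^sup>2 \<le> \<alpha>"
proof -
  define \<sigma> where "\<sigma> = largest_singular_value B"
  have "\<sigma> \<in> singular_values B"
    unfolding \<sigma>_def largest_singular_value_def
    by (intro Max_in finite_singular_values[OF B] singular_values_nonempty[OF B n])
  then have "eigenvalue (mat_adjoint B * B) (of_real (\<sigma>\<^sup>2))" unfolding singular_values_def by simp
  from eigenvalue_adjoint_mult[OF B this] obtain v where v: "(\<Sum>a<n. (cmod (v a))\<^sup>2) > 0"
      "\<And>a. a < n \<Longrightarrow> (\<Sum>c<m. cnj (B $$ (c, a)) * (\<Sum>j<n. B $$ (c, j) * v j)) = of_real (\<sigma>\<^sup>2) * v a"
    by blast
  define w where "w c = (\<Sum>j<n. B $$ (c, j) * v j)" for c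
  define S where "S = (\<Sum>a<n. (cmod (v a))\<^sup>2)"
  have "of_real (\<Sum>c<m. (cmod (w c))\<^sup>2) = of_real (\<sigma>\<^sup>2) * complex_of_real S"
    unfolding w_def S_def by (rule adjoint_mult_eigenvector_norm) (rule v(2))
  then have w: "(\<Sum>c<m. (cmod (w c))\<^sup>2) = \<sigma>\<^sup>2 * S"
    by (simp only: of_real_mult[symmetric] of_real_eq_iff)
  show ?thesis
  proof (cases "\<sigma> = 0")
    case True
    \<comment> \<open>Here B v = 0, so w = B v carries no information; the all-ones vector in its
      place still yields \<alpha> \<ge> 0.\<close>
    have "0 \<le> \<alpha> * (S * (\<Sum>c<m. (cmod ((\<lambda>_. 1) c))\<^sup>2))"
      unfolding S_def by (rule order_trans[OF zero_le_power2 bound])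
    then have nonneg: "0 \<le> \<alpha> * (S * real m)" by simp
    have "0 < S * real m" using v(1) m unfolding S_def by simp
    then have "0 \<le> \<alpha>" using nonneg mult_neg_pos[of \<alpha> "S * real m"] by linarith
    then show ?thesis using True unfolding \<sigma>_def by simp
  next
    case False
    have "(\<Sum>a<n. (\<Sum>c<m. cnj (w c) * B $$ (c, a)) * v a) =
      (\<Sum>c<m. cnj (w c) * (\<Sum>a<n. B $$ (c, a) * v a))"
      by (simp add: sum_distrib_left sum_distrib_right sum.swap[where B = "{..<m}"] mult_ac)
    also have "\<dots> = (\<Sum>c<m. cnj (w c) * w c)" unfolding w_def ..
    also have "\<dots> = of_real (\<Sum>c<m. (cmod (w c))\<^sup>2)"
      by (simp only: of_real_sum complex_norm_square mult.commute[of "cnj _"])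
    finally have "(\<sigma>\<^sup>2 * S)\<^sup>2 \<le> \<alpha> * (S * (\<sigma>\<^sup>2 * S))"
      using bound[of w v] unfolding w S_def[symmetric] by (simp flip: of_real_mult of_real_power)
    then have "\<sigma>\<^sup>2 * (\<sigma>\<^sup>2 * S\<^sup>2) \<le> \<alpha> * (\<sigma>\<^sup>2 * S\<^sup>2)"
      by (simp add: power2_eq_square mult_ac)
    moreover have "\<sigma>\<^sup>2 * S\<^sup>2 > 0" using False v(1) unfolding S_def by simp
    ultimately show ?thesis unfolding \<sigma>_def by (rule mult_right_le_imp_le)
  qed
qed

theorem corollary4p10:
  fixes m n k :: nat and \<alpha> :: real and B :: "complex mat"
  assumes "1 \<le> m" and "1 \<le> n" and "1 \<le> k" and "k \<le> m"
    and "B \<in> carrier_mat m n"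
  shows "k_copositive n m k (Phi_minus \<alpha> B) \<longleftrightarrow> (largest_singular_value B)\<^sup>2 \<le> \<alpha>"
proof
  assume "k_copositive n m k (Phi_minus \<alpha> B)"
  then show "(largest_singular_value B)\<^sup>2 \<le> \<alpha>"
    using assms by (intro largest_singular_value_le_if_bound[of B m n] k_copositive_Phi_minus_imp_bound[of B m n k]) auto
next
  assume "(largest_singular_value B)\<^sup>2 \<le> \<alpha>"
  then show "k_copositive n m k (Phi_minus \<alpha> B)"
    using assms by (intro k_copositive_Phi_minus_if_bound norm_adjoint_mult_le_largest_singular_value) auto
qed

end
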